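(* Let $k\geqslant2$ be an integer. A sequence $(x_n)_{n\in\mathbb N}\subseteq[0,1]$ is uniformly distributed mod $1$ if and only if it has Poissonian $(k,0)$--correlations, i.e. $\lim_{N\to\infty}R_k(0;\mathcal R,N)=\lambda(\mathcal R)$ for every closed rectangle $\mathcal R=[a_1,b_1]\times\cdots\times[a_{k-1},b_{k-1}]\subseteq[-\frac12,\frac12]^{k-1}$.
   Context: For $x\in\mathbb R$, $(\!(x)\!)$ denotes the signed distance from $x$ to the nearest integer, i.e. the unique $y\in(-\frac12,\frac12]$ with $x-y\in\mathbb Z$. For $k\geqslant2$, $0\leqslant\beta\leqslant1$, $N\geqslant1$ and a closed rectangle $\mathcal R\subseteq\mathbb R^{k-1}$, $R_k(\beta;\mathcal R,N)=\frac{1}{N^{k-(k-1)\beta}}\#\{(i_1,\dots,i_k)\in\{1,\dots,N\}^k \text{ pairwise distinct}: N^{\beta}((\!(x_{i_1}-x_{i_2})\!),\dots,(\!(x_{i_1}-x_{i_k})\!))\in\mathcal R\}$. $\lambda$ is $(k-1)$-dimensional Lebesgue measure. Uniform distribution mod $1$ means $\lim_{N\to\infty}\frac1N\#\{i\leqslant N:x_i\in[a,b]\}=b-a$ for all $0\leqslant a<b\leqslant1$. *)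

theory Defs
  imports "HOL-Analysis.Analysis"
begin

definition signed_dist :: "real \<Rightarrow> real" where
  "signed_dist x = (THE y. - (1/2) < y \<and> y \<le> 1/2 \<and> x - y \<in> \<int>)"

lemma signed_dist_eqI:
  assumes "- (1/2) < y" "y \<le> 1/2" "x - y \<in> \<int>"
  shows "signed_dist x = y"
  unfolding signed_dist_def
proof (rule the_equality)
  show "- (1/2) < y \<and> y \<le> 1/2 \<and> x - y \<in> \<int>"
    using assms by simp
next
  fix z assume z: "- (1/2) < z \<and> z \<le> 1/2 \<and> x - z \<in> \<int>"
  have "(x - y) - (x - z) \<in> \<int>"
    using assms(3) z by (blast intro: Ints_diff)
  then obtain n :: int where n: "z - y = of_int n"
    by (auto elim: Ints_cases)
  with assms z have "-1 < real_of_int n" "real_of_int n < 1"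
    by linarith+
  then have "n = 0"
    by linarith
  with n show "z = y"
    by simp
qed

lemma signed_dist_ceiling: "signed_dist x = x - of_int \<lceil>x - 1/2\<rceil>"
  by (rule signed_dist_eqI) (linarith, linarith, simp)

lemma signed_dist_bounds: "- (1/2) < signed_dist x" "signed_dist x \<le> 1/2"
  and signed_dist_diff_Ints: "x - signed_dist x \<in> \<int>"
  unfolding signed_dist_ceiling by (linarith, linarith, simp)

text \<open>
  Points of \<open>\<real>\<^sup>k\<^sup>-\<^sup>1\<close> are extensional functions on \<open>{1..k-1}\<close>, so that sets of points live in the
  space of \<open>Pi\<^sub>M {1..k-1} (\<lambda>_. lborel)\<close>. Index tuples \<open>(i\<^sub>1, \<dots>, i\<^sub>k)\<close> are extensional functions
  on \<open>{1..k}\<close>, and sequences start at index 1.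
\<close>

definition scaled_differences :: "(nat \<Rightarrow> real) \<Rightarrow> nat \<Rightarrow> real \<Rightarrow> nat \<Rightarrow> (nat \<Rightarrow> nat) \<Rightarrow> (nat \<Rightarrow> real)" where
  "scaled_differences x k \<beta> N i =
     (\<lambda>m\<in>{1..k-1}. real N powr \<beta> * signed_dist (x (i 1) - x (i (m + 1))))"

definition correlation_count ::
    "(nat \<Rightarrow> real) \<Rightarrow> nat \<Rightarrow> real \<Rightarrow> (nat \<Rightarrow> real) set \<Rightarrow> nat \<Rightarrow> real" where
  "correlation_count x k \<beta> R N =
     1 / real N powr (real k - (real k - 1) * \<beta>) *
     real (card {i \<in> {1..k} \<rightarrow>\<^sub>E {1..N}. inj_on i {1..k} \<and> scaled_differences x k \<beta> N i \<in> R})"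

definition closed_rectangle :: "nat \<Rightarrow> (nat \<Rightarrow> real) set \<Rightarrow> bool" where
  "closed_rectangle d R \<longleftrightarrow>
     (\<exists>a b. (\<forall>m\<in>{1..d}. a m \<le> b m) \<and> R = (\<Pi>\<^sub>E m\<in>{1..d}. {a m..b m}))"

text \<open>For \<open>\<beta> = 0\<close> only rectangles inside \<open>[-1/2, 1/2]\<^sup>k\<^sup>-\<^sup>1\<close> are tested, since the differences are
  not rescaled.\<close>

definition poissonian_k0_correlations :: "nat \<Rightarrow> (nat \<Rightarrow> real) \<Rightarrow> bool" where
  "poissonian_k0_correlations k x \<longleftrightarrow>
     (\<forall>R. closed_rectangle (k - 1) R \<and> R \<subseteq> (\<Pi>\<^sub>E m\<in>{1..k-1}. {-(1/2)..1/2}) \<longrightarrow>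
        (\<lambda>N. correlation_count x k 0 R N) \<longlonglongrightarrow> measure (Pi\<^sub>M {1..k-1} (\<lambda>_. lborel)) R)"

definition uniformly_distributed_mod_1 :: "(nat \<Rightarrow> real) \<Rightarrow> bool" where
  "uniformly_distributed_mod_1 x \<longleftrightarrow>
     (\<forall>a b. 0 \<le> a \<and> a < b \<and> b \<le> 1 \<longrightarrow>
        (\<lambda>N. 1 / real N * real (card {i \<in> {1..N}. x i \<in> {a..b}})) \<longlonglongrightarrow> b - a)"

end

theory Submission imports Defs begin

text \<open>
  Tuples with a repeated index are negligible, and without the distinctness condition the count
  factors as \<open>\<Sum>\<^sub>j \<Prod>\<^sub>m #{l. signed_dist (x\<^sub>j - x\<^sub>l) \<in> [a\<^sub>m, b\<^sub>m]}\<close>. If \<open>x\<close> is uniformly distributed, each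
  factor is \<open>N (b\<^sub>m - a\<^sub>m) + o(N)\<close> uniformly in \<open>j\<close>, since finitely many cells control all arcs.

  Conversely, the rectangle \<open>[-c, c] \<times> [-1/2, 1/2]\<^sup>k\<^sup>-\<^sup>2\<close> yields the pair correlations. Cut the circle
  into \<open>L\<close> cells and let \<open>F\<^sub>s\<close> be the frequency of \<open>x\<close> in the window of \<open>m\<close> cells starting at cell \<open>s\<close>.
  Two points at circular distance about \<open>d/L\<close> share \<open>m - d\<close> windows, so the pair correlations bound
  \<open>\<Sum>\<^sub>s F\<^sub>s\<^sup>2\<close>, and \<open>\<Sum>\<^sub>s (F\<^sub>s - m/L)\<^sup>2 \<le> m/L + o(1) < 1\<close>. An interval contained in \<open>q\<^sup>2\<close> windows therefore
  has frequency at most \<open>m/L + 1/q\<close>; with \<open>L = q\<^sup>3\<close> this is its length up to \<open>O(1/q)\<close>. Such upper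
  bounds suffice, by passing to complements.
\<close>

section \<open>Averages and frequencies\<close>

definition average :: "nat \<Rightarrow> (nat \<Rightarrow> real) \<Rightarrow> real" where
  "average N f = (\<Sum>i=1..N. f i) / real N"

definition frequency :: "nat \<Rightarrow> (nat \<Rightarrow> bool) \<Rightarrow> real" where
  "frequency N P = average N (\<lambda>i. of_bool (P i))"

lemma average_mono:
  assumes "\<And>i. 1 \<le> i \<Longrightarrow> i \<le> N \<Longrightarrow> f i \<le> g i"
  shows "average N f \<le> average N g"
  unfolding average_def using assms by (intro divide_right_mono sum_mono) auto

lemma average_const: "N > 0 \<Longrightarrow> average N (\<lambda>_. c) = c"
  by (simp add: average_def)

lemma average_sum: "average N (\<lambda>i. \<Sum>s\<in>S. f s i) = (\<Sum>s\<in>S. average N (f s))"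
  unfolding average_def sum_divide_distrib[symmetric] by (subst sum.swap) (rule refl)

lemma tendsto_average_uniform_limit:
  assumes "uniform_limit UNIV f (\<lambda>_. c) sequentially"
  shows "(\<lambda>N. average N (f N)) \<longlonglongrightarrow> c"
proof (rule tendstoI)
  fix \<epsilon> :: real assume "\<epsilon> > 0"
  then have "\<forall>\<^sub>F N in sequentially. \<forall>i\<in>UNIV. dist (f N i) c < \<epsilon> / 2"
    using assms by (intro uniform_limitD) auto
  with eventually_gt_at_top[of 0] show "\<forall>\<^sub>F N in sequentially. dist (average N (f N)) c < \<epsilon>"
  proof eventually_elim
    case (elim N)
    have bounds: "c - \<epsilon> / 2 \<le> f N i" "f N i \<le> c + \<epsilon> / 2" for i
      using bspec[OF elim(2) UNIV_I, of i] unfolding dist_real_def by linarith+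
    have "average N (\<lambda>_. c - \<epsilon> / 2) \<le> average N (f N)" "average N (f N) \<le> average N (\<lambda>_. c + \<epsilon> / 2)"
      by (intro average_mono bounds)+
    with elim(1) \<open>\<epsilon> > 0\<close> show ?case
      unfolding average_const[OF elim(1)] dist_real_def by linarith
  qed
qed

lemma frequency_eq_card: "frequency N P = real (card {i \<in> {1..N}. P i}) / real N"
  by (simp add: frequency_def average_def Int_def)

lemma frequency_nonneg: "0 \<le> frequency N P"
  by (simp add: frequency_eq_card)

lemma frequency_mono:
  assumes "\<And>i. 1 \<le> i \<Longrightarrow> i \<le> N \<Longrightarrow> P i \<Longrightarrow> Q i"
  shows "frequency N P \<le> frequency N Q"
  unfolding frequency_def using assms by (intro average_mono) auto

lemma frequency_eq_1:
  assumes "N > 0" "\<And>i. P i"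
  shows "frequency N P = 1"
  using assms by (simp add: frequency_def average_const)

lemma frequency_disj_le: "frequency N (\<lambda>i. P i \<or> Q i) \<le> frequency N P + frequency N Q"
  unfolding frequency_def average_def add_divide_distrib[symmetric] sum.distrib[symmetric]
  by (intro divide_right_mono sum_mono) auto

lemma sum_frequency:
  assumes "finite S"
  shows "(\<Sum>s\<in>S. frequency N (P s)) = average N (\<lambda>i. real (card {s \<in> S. P s i}))"
  using assms by (simp add: frequency_def average_sum[symmetric] Int_def)

lemma sum_frequency_power2:
  assumes "finite S"
  shows "(\<Sum>s\<in>S. (frequency N (P s))\<^sup>2)
           = average N (\<lambda>i. average N (\<lambda>j. real (card {s \<in> S. P s i \<and> P s j})))"
proof -
  have "(frequency N (P s))\<^sup>2 = average N (\<lambda>i. average N (\<lambda>j. of_bool (P s i \<and> P s j)))" for s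
    by (simp only: frequency_def average_def power2_eq_square times_divide_times_eq sum_product
        of_bool_conj sum_divide_distrib[symmetric] divide_divide_eq_left)
  then have "(\<Sum>s\<in>S. (frequency N (P s))\<^sup>2)
      = average N (\<lambda>i. average N (\<lambda>j. \<Sum>s\<in>S. of_bool (P s i \<and> P s j)))"
    by (simp only: average_sum)
  then show ?thesis using assms by (simp add: Int_def)
qed

lemma frequency_Bex_le:
  assumes "finite S" and "\<And>i. 1 \<le> i \<Longrightarrow> i \<le> N \<Longrightarrow> P i \<Longrightarrow> \<exists>s\<in>S. Q s i"
  shows "frequency N P \<le> (\<Sum>s\<in>S. frequency N (Q s))"
  unfolding sum_frequency[OF assms(1)] unfolding frequency_def
proof (rule average_mono)
  fix i assume i: "1 \<le> i" "i \<le> N"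
  have "card {s \<in> S. Q s i} > 0" if "P i"
    using assms i that by (auto simp: card_gt_0_iff)
  then show "of_bool (P i) \<le> real (card {s \<in> S. Q s i})" by (auto simp: Suc_leI)
qed

lemma abs_frequency_diff_le_if_cover:
  assumes "N > 0" and "\<And>i. 1 \<le> i \<Longrightarrow> i \<le> N \<Longrightarrow> P i \<or> Q i \<or> R i" and "p + q + r = 1"
    and "frequency N P \<le> p + \<epsilon>" "frequency N Q \<le> q + \<epsilon>" "frequency N R \<le> r + \<epsilon>" and "\<epsilon> \<ge> 0"
  shows "\<bar>frequency N P - p\<bar> \<le> 2 * \<epsilon>"
proof -
  have "1 = frequency N (\<lambda>_. True)" using assms(1) by (simp add: frequency_eq_1)
  also have "\<dots> \<le> frequency N (\<lambda>i. P i \<or> Q i \<or> R i)" using assms(2) by (rule frequency_mono)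
  also have "\<dots> \<le> frequency N P + (frequency N Q + frequency N R)"
    using frequency_disj_le[of N P "\<lambda>i. Q i \<or> R i"] frequency_disj_le[of N Q R] by linarith
  finally show ?thesis using assms by linarith
qed

lemma uniformly_distributed_mod_1_iff_frequency:
  "uniformly_distributed_mod_1 x \<longleftrightarrow>
     (\<forall>a b. 0 \<le> a \<and> a < b \<and> b \<le> 1 \<longrightarrow> (\<lambda>N. frequency N (\<lambda>i. x i \<in> {a..b})) \<longlonglongrightarrow> b - a)"
  unfolding uniformly_distributed_mod_1_def frequency_eq_card by simp

section \<open>Windows on the circle\<close>

text \<open>With the circle cut into \<open>L\<close> equal cells, the preimage in \<open>\<real>\<close> of the \<open>m\<close> cells from cell \<open>s\<close> on.\<close>

definition circle_window :: "int \<Rightarrow> int \<Rightarrow> int \<Rightarrow> real set" where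
  "circle_window L m s = {t. (\<lfloor>of_int L * t\<rfloor> - s) mod L < m}"

lemma circle_window_mod: "circle_window L m (s mod L) = circle_window L m s"
  by (simp add: circle_window_def mod_simps)

lemma bij_betw_diff_mod:
  fixes p L :: int
  assumes "0 < L"
  shows "bij_betw (\<lambda>s. (p - s) mod L) {0..<L} {0..<L}"
  using assms
  by (intro bij_betw_byWitness[where f' = "\<lambda>s. (p - s) mod L"]) (auto simp: mod_simps)

lemma card_circle_windows_containing:
  assumes "0 < L" "m \<le> L"
  shows "card {s \<in> {0..<L}. t \<in> circle_window L m s} = nat m"
proof -
  have "card {s \<in> {0..<L}. (\<lfloor>L * t\<rfloor> - s) mod L < m} = card {u \<in> {0..<L}. u < m}"
    by (rule bij_betw_same_card[OF bij_betw_Collect[OF bij_betw_diff_mod[OF assms(1)]]]) (rule refl)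
  also have "{u \<in> {0..<L}. u < m} = {0..<m}" using assms(2) by auto
  finally show ?thesis by (simp add: circle_window_def)
qed

definition residue_dist :: "int \<Rightarrow> int \<Rightarrow> int" where
  "residue_dist L d = min (d mod L) (L - d mod L)"

lemma card_residue_windows_containing_both_le:
  fixes L m p q :: int
  assumes "0 < L" "2 * m \<le> L"
  shows "card {s \<in> {0..<L}. (p - s) mod L < m \<and> (q - s) mod L < m} \<le> nat (m - residue_dist L (q - p))"
    (is "card ?S \<le> _")
proof -
  define e where "e = (q - p) mod L"
  define A where "A = (if 2 * e \<le> L then {0..<m - e} else {L - e..<m})"
  have "inj_on (\<lambda>s. (p - s) mod L) ?S"
    using bij_betw_imp_inj_on[OF bij_betw_diff_mod[OF assms(1)]] by (rule inj_on_subset) auto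
  moreover have "(\<lambda>s. (p - s) mod L) ` ?S \<subseteq> A"
  proof (rule image_subsetI)
    fix s assume s: "s \<in> ?S"
    define u where "u = (p - s) mod L"
    have "(u + e) mod L = (q - s) mod L" by (simp add: u_def e_def mod_simps)
    with s have less_m: "(u + e) mod L < m" "u < m" by (simp_all add: u_def)
    have ranges: "0 \<le> u" "0 \<le> e" "e < L" using assms(1) by (simp_all add: u_def e_def)
    have "u + e < m" if "u + e < L" using less_m(1) ranges that by simp
    then show "(p - s) mod L \<in> A"
      unfolding u_def[symmetric] A_def using ranges less_m(2) assms(2) by (auto; linarith)
  qed
  ultimately have "card ?S \<le> card A" by (rule card_inj_on_le) (simp add: A_def)
  also have "\<dots> = nat (m - residue_dist L (q - p))" by (simp add: A_def residue_dist_def e_def min_def)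
  finally show ?thesis .
qed

lemma abs_signed_dist_le_abs_diff_int: "\<bar>signed_dist t\<bar> \<le> \<bar>t - of_int n\<bar>"
proof (cases "t - of_int n = signed_dist t")
  case False
  obtain l where l: "t - signed_dist t = of_int l"
    using signed_dist_diff_Ints by (auto elim: Ints_cases)
  with False have "n \<le> l - 1 \<or> n \<ge> l + 1" by force
  then have "real_of_int n \<le> of_int l - 1 \<or> real_of_int n \<ge> of_int l + 1" by linarith
  then show ?thesis using l signed_dist_bounds[of t] by linarith
qed simp

lemma abs_signed_dist_diff_le_residue_dist:
  fixes L :: int and x y :: real
  assumes "0 < L"
  shows "\<bar>signed_dist (x - y)\<bar> \<le> (residue_dist L (\<lfloor>L * x\<rfloor> - \<lfloor>L * y\<rfloor>) + 1) / L"
proof -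
  define e where "e = (\<lfloor>L * x\<rfloor> - \<lfloor>L * y\<rfloor>) mod L"
  define n where "n = (\<lfloor>L * x\<rfloor> - \<lfloor>L * y\<rfloor>) div L"
  have "\<lfloor>L * x\<rfloor> - \<lfloor>L * y\<rfloor> = e + L * n" by (simp add: e_def n_def)
  then have "real_of_int \<lfloor>L * x\<rfloor> - \<lfloor>L * y\<rfloor> = e + L * n"
    by (metis of_int_diff of_int_add of_int_mult)
  then have deviation: "\<bar>L * x - L * y - L * n - e\<bar> < 1" by linarith
  have range: "0 \<le> e" "e < L" using assms(1) by (simp_all add: e_def)
  have unscale: "\<bar>x - y - l\<bar> \<le> c / L" if "\<bar>L * x - L * y - L * l\<bar> \<le> c" for l :: int and c :: real
  proof -
    have "L * \<bar>x - y - l\<bar> = \<bar>L * x - L * y - L * l\<bar>"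
      using assms(1) abs_mult_pos'[of "real_of_int L" "x - y - l"] by (simp add: right_diff_distrib)
    with that assms(1) show ?thesis by (simp add: pos_le_divide_eq mult.commute)
  qed
  have "\<bar>x - y - n\<bar> \<le> (e + 1) / L"
    using deviation range by (intro unscale) linarith
  moreover have "\<bar>x - y - (n + 1)\<bar> \<le> (L - e + 1) / L"
    using deviation range by (intro unscale) (simp add: distrib_left abs_le_iff; linarith)
  ultimately show ?thesis
    using abs_signed_dist_le_abs_diff_int[of "x - y" n]
      abs_signed_dist_le_abs_diff_int[of "x - y" "n + 1"]
    by (simp add: residue_dist_def e_def min_def)
qed

lemma card_circle_windows_containing_both_le:
  assumes "0 < L" "2 * m \<le> L"
  shows "card {s \<in> {0..<L}. x \<in> circle_window L m s \<and> y \<in> circle_window L m s}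
           \<le> card {v \<in> {1..m}. \<bar>signed_dist (x - y)\<bar> \<le> of_int v / of_int L}"
    (is "card ?S \<le> card ?V")
proof -
  define d where "d = residue_dist L (\<lfloor>L * x\<rfloor> - \<lfloor>L * y\<rfloor>)"
  have "0 \<le> d" using assms(1) by (simp add: d_def residue_dist_def less_imp_le)
  have "card ?S \<le> nat (m - d)"
    using card_residue_windows_containing_both_le[OF assms, of "\<lfloor>L * y\<rfloor>" "\<lfloor>L * x\<rfloor>"]
    by (simp add: circle_window_def d_def conj_commute)
  also have "\<dots> = card {d + 1..m}" by simp
  also have "\<dots> \<le> card ?V"
  proof (intro card_mono subsetI)
    fix v assume v: "v \<in> {d + 1..m}"
    have "\<bar>signed_dist (x - y)\<bar> \<le> (d + 1) / L"
      unfolding d_def by (rule abs_signed_dist_diff_le_residue_dist[OF assms(1)])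
    also have "\<dots> \<le> of_int v / of_int L"
      using v assms(1) by (intro divide_right_mono) (simp_all flip: of_int_le_iff)
    finally show "v \<in> ?V" using v \<open>0 \<le> d\<close> by simp
  qed (rule rev_finite_subset[of "{1..m}"]; auto)
  finally show ?thesis .
qed

lemma interval_subset_circle_window:
  assumes "0 < L" and a: "a \<in> circle_window L w s" and m: "m = \<lfloor>L * b\<rfloor> - \<lfloor>L * a\<rfloor> + w" "m \<le> L"
  shows "{a..b} \<subseteq> circle_window L m s"
proof
  fix t assume "t \<in> {a..b}"
  then have floors: "\<lfloor>L * a\<rfloor> \<le> \<lfloor>L * t\<rfloor>" "\<lfloor>L * t\<rfloor> \<le> \<lfloor>L * b\<rfloor>"
    using assms(1) by (auto intro!: floor_mono)
  define u where "u = (\<lfloor>L * a\<rfloor> - s) mod L"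
  have range: "0 \<le> u" "u < w" using assms(1) a by (simp_all add: u_def circle_window_def)
  have "(\<lfloor>L * t\<rfloor> - s) mod L = (\<lfloor>L * t\<rfloor> - \<lfloor>L * a\<rfloor> + u) mod L"
    unfolding u_def mod_add_right_eq by (simp add: algebra_simps)
  also have "\<dots> = \<lfloor>L * t\<rfloor> - \<lfloor>L * a\<rfloor> + u"
    using floors range m by (intro mod_pos_pos_trivial) auto
  also have "\<dots> < m" using floors range m by linarith
  finally show "t \<in> circle_window L m s" by (simp add: circle_window_def)
qed

section \<open>Arcs under uniform distribution\<close>

lemma unit_circle_window_subset:
  fixes L r :: int
  assumes "0 < L" "r \<in> {0..<L}"
  shows "circle_window L 1 r \<inter> {0..1} \<subseteq> {r / L..(r + 1) / L} \<union> {1}"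
proof
  fix t assume t: "t \<in> circle_window L 1 r \<inter> {0..1}"
  show "t \<in> {r / L..(r + 1) / L} \<union> {1}"
  proof (cases "t = 1")
    case False
    with t assms(1) have "0 \<le> L * t" "L * t < L" by auto
    then have "\<lfloor>L * t\<rfloor> \<in> {0..<L}" by (simp add: floor_less_iff)
    moreover have "(\<lfloor>L * t\<rfloor> - r) mod L = 0"
      using t pos_mod_sign[OF assms(1), of "\<lfloor>L * t\<rfloor> - r"] unfolding circle_window_def by auto
    then have "\<lfloor>L * t\<rfloor> mod L = r mod L"
      by (metis mod_eq_dvd_iff dvd_eq_mod_eq_0)
    ultimately have "\<lfloor>L * t\<rfloor> = r" using assms(2) by simp
    then have "r \<le> L * t" "L * t \<le> r + 1" by linarith+
    with assms(1) show ?thesis by (simp add: field_simps)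
  qed simp
qed

lemma frequency_unit_circle_window_upper:
  assumes ud: "uniformly_distributed_mod_1 x" and x: "\<And>n. n \<ge> 1 \<Longrightarrow> x n \<in> {0..1}"
    and "0 < L" "r \<in> {0..<L}" "0 < \<epsilon>"
  shows "\<forall>\<^sub>F N in sequentially. frequency N (\<lambda>i. x i \<in> circle_window L 1 r) \<le> 1 / L + \<epsilon>"
proof -
  define \<delta> where "\<delta> = min 1 (\<epsilon> / 2)"
  have \<delta>: "0 < \<delta>" "\<delta> \<le> 1" "\<delta> < \<epsilon>" using \<open>0 < \<epsilon>\<close> by (auto simp: \<delta>_def)
  note frequency_limit = ud[unfolded uniformly_distributed_mod_1_iff_frequency, rule_format]
  have "real_of_int r + 1 \<le> L" using \<open>r \<in> {0..<L}\<close> by (simp; linarith)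
  with assms(3,4) have "(\<lambda>N. frequency N (\<lambda>i. x i \<in> {r / L..(r + 1) / L})) \<longlonglongrightarrow> (r + 1) / L - r / L"
    by (intro frequency_limit) (auto simp: field_simps)
  moreover have "(\<lambda>N. frequency N (\<lambda>i. x i \<in> {1 - \<delta>..1})) \<longlonglongrightarrow> 1 - (1 - \<delta>)"
    using \<delta> by (intro frequency_limit) auto
  ultimately have "(\<lambda>N. frequency N (\<lambda>i. x i \<in> {r / L..(r + 1) / L})
      + frequency N (\<lambda>i. x i \<in> {1 - \<delta>..1})) \<longlonglongrightarrow> ((r + 1) / L - r / L) + (1 - (1 - \<delta>))"
    by (rule tendsto_add)
  moreover have "((r + 1) / L - r / L) + (1 - (1 - \<delta>)) < 1 / L + \<epsilon>"
    using \<delta> by (simp add: diff_divide_distrib[symmetric])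
  ultimately have "\<forall>\<^sub>F N in sequentially. frequency N (\<lambda>i. x i \<in> {r / L..(r + 1) / L})
      + frequency N (\<lambda>i. x i \<in> {1 - \<delta>..1}) < 1 / L + \<epsilon>"
    by (rule order_tendstoD(2))
  then show ?thesis
  proof eventually_elim
    case (elim N)
    have "frequency N (\<lambda>i. x i \<in> circle_window L 1 r)
        \<le> frequency N (\<lambda>i. x i \<in> {r / L..(r + 1) / L} \<or> x i \<in> {1 - \<delta>..1})"
      using unit_circle_window_subset[OF assms(3,4)] x \<delta> by (intro frequency_mono) fastforce
    also note frequency_disj_le
    also note elim
    finally show ?case by simp
  qed
qed

lemma frequency_unit_circle_windows_upper:
  assumes "uniformly_distributed_mod_1 x" "\<And>n. n \<ge> 1 \<Longrightarrow> x n \<in> {0..1}" "0 < L" "0 < \<epsilon>"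
  shows "\<forall>\<^sub>F N in sequentially. \<forall>s. frequency N (\<lambda>i. x i \<in> circle_window L 1 s) \<le> 1 / L + \<epsilon>"
proof -
  have "\<forall>\<^sub>F N in sequentially. \<forall>r\<in>{0..<L}. frequency N (\<lambda>i. x i \<in> circle_window L 1 r) \<le> 1 / L + \<epsilon>"
    using assms by (intro eventually_ball_finite ballI frequency_unit_circle_window_upper) auto
  then show ?thesis
  proof eventually_elim
    case (elim N)
    then have "frequency N (\<lambda>i. x i \<in> circle_window L 1 (s mod L)) \<le> 1 / L + \<epsilon>" for s
      using \<open>0 < L\<close> by simp
    then show ?case by (simp add: circle_window_mod)
  qed
qed

lemma mem_unit_circle_window_diff_signed_dist:
  assumes "0 < L"
  shows "t \<in> circle_window L 1 \<lfloor>L * (y - signed_dist (y - t))\<rfloor>"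
proof -
  obtain n where n: "y - t - signed_dist (y - t) = of_int n"
    using signed_dist_diff_Ints by (auto elim: Ints_cases)
  have "L * (y - signed_dist (y - t)) = L * t + of_int (L * n)"
    using n by (simp add: algebra_simps flip: n)
  then show ?thesis
    using assms by (simp add: circle_window_def floor_add_int[symmetric] del: of_int_mult)
qed

lemma frequency_arc_le:
  assumes "0 < L" "a \<le> b" and \<beta>: "\<And>s. frequency N (\<lambda>i. x i \<in> circle_window L 1 s) \<le> \<beta>"
  shows "frequency N (\<lambda>i. signed_dist (y - x i) \<in> {a..b}) \<le> (L * (b - a) + 2) * \<beta>"
proof -
  define Q where "Q = {\<lfloor>L * (y - b)\<rfloor>..\<lfloor>L * (y - a)\<rfloor>}"
  have "frequency N (\<lambda>i. signed_dist (y - x i) \<in> {a..b})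
      \<le> (\<Sum>q\<in>Q. frequency N (\<lambda>i. x i \<in> circle_window L 1 q))"
  proof (rule frequency_Bex_le)
    fix i assume "signed_dist (y - x i) \<in> {a..b}"
    then have "\<lfloor>L * (y - signed_dist (y - x i))\<rfloor> \<in> Q"
      using assms(1) by (auto simp: Q_def intro!: floor_mono)
    with mem_unit_circle_window_diff_signed_dist[OF assms(1)]
    show "\<exists>q\<in>Q. x i \<in> circle_window L 1 q" by blast
  qed (simp add: Q_def)
  also have "\<dots> \<le> (\<Sum>q\<in>Q. \<beta>)" by (rule sum_mono) (rule \<beta>)
  also have "\<dots> = real (card Q) * \<beta>" by simp
  also have "\<dots> \<le> (L * (b - a) + 2) * \<beta>"
  proof (rule mult_right_mono)
    have "0 \<le> L * (b - a)" using assms by simp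
    then show "real (card Q) \<le> L * (b - a) + 2"
      unfolding Q_def card_atLeastAtMost_int by (simp add: algebra_simps) linarith
    show "0 \<le> \<beta>" using frequency_nonneg \<beta> by (rule order_trans)
  qed
  finally show ?thesis .
qed

lemma frequency_arcs_upper:
  assumes ud: "uniformly_distributed_mod_1 x" and x: "\<And>n. n \<ge> 1 \<Longrightarrow> x n \<in> {0..1}"
    and "\<epsilon> > 0"
  shows "\<forall>\<^sub>F N in sequentially. \<forall>y a b. a \<le> b \<and> b \<le> a + 1 \<longrightarrow>
           frequency N (\<lambda>i. signed_dist (y - x i) \<in> {a..b}) \<le> b - a + \<epsilon>"
proof -
  define L where "L = max 1 \<lceil>5 / \<epsilon>\<rceil>"
  have L: "0 < L" "1 \<le> real_of_int L" by (simp_all add: L_def)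
  have "5 / \<epsilon> \<le> L" unfolding L_def by linarith
  with L \<open>\<epsilon> > 0\<close> have "5 / L \<le> \<epsilon>" by (simp add: field_simps)
  have "\<forall>\<^sub>F N in sequentially. \<forall>s. frequency N (\<lambda>i. x i \<in> circle_window L 1 s) \<le> 1 / L + 1 / L\<^sup>2"
    using ud x L by (intro frequency_unit_circle_windows_upper) auto
  then show ?thesis
  proof (eventually_elim, intro allI impI)
    fix N y a b
    assume windows: "\<forall>s. frequency N (\<lambda>i. x i \<in> circle_window L 1 s) \<le> 1 / L + 1 / L\<^sup>2"
      and ab: "a \<le> b \<and> b \<le> a + (1::real)"
    have "frequency N (\<lambda>i. signed_dist (y - x i) \<in> {a..b}) \<le> (L * (b - a) + 2) * (1 / L + 1 / L\<^sup>2)"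
      using L(1) ab windows by (intro frequency_arc_le) auto
    also have "\<dots> = (b - a) + ((b - a) + 2) / L + 2 / L\<^sup>2"
      using L by (simp add: field_simps power2_eq_square)
    also have "\<dots> \<le> (b - a) + 3 / L + 2 / L"
      using L ab by (intro add_mono divide_right_mono divide_left_mono) (auto simp: power2_eq_square)
    also have "\<dots> = (b - a) + 5 / L" by simp
    finally show "frequency N (\<lambda>i. signed_dist (y - x i) \<in> {a..b}) \<le> b - a + \<epsilon>"
      using \<open>5 / L \<le> \<epsilon>\<close> by linarith
  qed
qed

lemma uniform_limit_frequency_arc:
  assumes ud: "uniformly_distributed_mod_1 x" and x: "\<And>n. n \<ge> 1 \<Longrightarrow> x n \<in> {0..1}"
    and ab: "-(1/2) \<le> a" "a \<le> b" "b \<le> 1/2"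
  shows "uniform_limit UNIV (\<lambda>N y. frequency N (\<lambda>i. signed_dist (y - x i) \<in> {a..b}))
           (\<lambda>_. b - a) sequentially"
proof (rule uniform_limitI)
  fix \<epsilon> :: real assume "\<epsilon> > 0"
  let ?F = "\<lambda>N y a b. frequency N (\<lambda>i. signed_dist (y - x i) \<in> {a..b})"
  have "\<forall>\<^sub>F N in sequentially. \<forall>y a b. a \<le> b \<and> b \<le> a + 1 \<longrightarrow> ?F N y a b \<le> b - a + \<epsilon> / 3"
    using ud x \<open>\<epsilon> > 0\<close> by (intro frequency_arcs_upper) auto
  with eventually_gt_at_top[of 0]
  show "\<forall>\<^sub>F N in sequentially. \<forall>y\<in>UNIV. dist (?F N y a b) (b - a) < \<epsilon>"
  proof (eventually_elim, intro ballI)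
    fix N y
    assume elim: "0 < N" "\<forall>y a b. a \<le> b \<and> b \<le> a + 1 \<longrightarrow> ?F N y a b \<le> b - a + \<epsilon> / 3"
    have "\<bar>?F N y a b - (b - a)\<bar> \<le> 2 * (\<epsilon> / 3)"
    proof (rule abs_frequency_diff_le_if_cover[OF elim(1)])
      show "?F N y a b \<le> (b - a) + \<epsilon> / 3" "?F N y (-(1/2)) a \<le> (a + 1/2) + \<epsilon> / 3"
        "?F N y b (1/2) \<le> (1/2 - b) + \<epsilon> / 3"
        using elim(2)[rule_format, of a b y] elim(2)[rule_format, of "-(1/2)" a y]
          elim(2)[rule_format, of b "1/2" y] ab by linarith+
      show "signed_dist (y - x i) \<in> {a..b} \<or> signed_dist (y - x i) \<in> {-(1/2)..a}
          \<or> signed_dist (y - x i) \<in> {b..1/2}" for i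
        using signed_dist_bounds[of "y - x i"] by auto
    qed (use \<open>\<epsilon> > 0\<close> in auto)
    with \<open>\<epsilon> > 0\<close> show "dist (?F N y a b) (b - a) < \<epsilon>" by (simp add: dist_real_def)
  qed
qed

section \<open>Uniform distribution from pair distances\<close>

definition pair_frequency :: "(nat \<Rightarrow> real) \<Rightarrow> nat \<Rightarrow> real \<Rightarrow> real" where
  "pair_frequency x N c = average N (\<lambda>i. frequency N (\<lambda>j. \<bar>signed_dist (x i - x j)\<bar> \<le> c))"

definition uniform_pair_distances :: "(nat \<Rightarrow> real) \<Rightarrow> bool" where
  "uniform_pair_distances x \<longleftrightarrow> (\<forall>c\<in>{0..1/2}. (\<lambda>N. pair_frequency x N c) \<longlonglongrightarrow> 2 * c)"

definition window_variance :: "(nat \<Rightarrow> real) \<Rightarrow> nat \<Rightarrow> int \<Rightarrow> int \<Rightarrow> real" where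
  "window_variance x N L m =
     (\<Sum>s\<in>{0..<L}. (frequency N (\<lambda>i. x i \<in> circle_window L m s) - m / L)\<^sup>2)"

lemma window_variance_le:
  assumes "0 < L" "0 \<le> m" "2 * m \<le> L" "0 < N"
  shows "window_variance x N L m \<le> (\<Sum>v=1..m. pair_frequency x N (of_int v / of_int L)) - (of_int m)\<^sup>2 / L"
proof -
  let ?F = "\<lambda>s. frequency N (\<lambda>i. x i \<in> circle_window L m s)"
  have "(\<Sum>s\<in>{0..<L}. ?F s) = average N (\<lambda>_. real (nat m))"
    using assms card_circle_windows_containing[of L m] by (simp add: sum_frequency)
  then have sum_frequencies: "(\<Sum>s\<in>{0..<L}. ?F s) = m" using assms by (simp add: average_const)
  have sum_squares: "(\<Sum>s\<in>{0..<L}. (?F s)\<^sup>2) \<le> (\<Sum>v=1..m. pair_frequency x N (of_int v / of_int L))"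
  proof -
    have "(\<Sum>s\<in>{0..<L}. (?F s)\<^sup>2)
        \<le> average N (\<lambda>i. average N (\<lambda>j. real (card {v \<in> {1..m}. \<bar>signed_dist (x i - x j)\<bar> \<le> of_int v / of_int L})))"
      unfolding sum_frequency_power2[OF finite_atLeastLessThan_int]
      by (intro average_mono of_nat_mono card_circle_windows_containing_both_le assms)
    also have "\<dots> = (\<Sum>v=1..m. pair_frequency x N (of_int v / of_int L))"
      unfolding pair_frequency_def average_sum[symmetric] by (simp add: sum_frequency)
    finally show ?thesis .
  qed
  have "window_variance x N L m
      = (\<Sum>s\<in>{0..<L}. (?F s)\<^sup>2) - 2 * (m / L) * (\<Sum>s\<in>{0..<L}. ?F s) + L * (m / L)\<^sup>2"
    using assms(1) by (simp add: window_variance_def power2_diff sum.distrib sum_subtractf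
        sum_distrib_left sum_divide_distrib mult_ac)
  also have "\<dots> = (\<Sum>s\<in>{0..<L}. (?F s)\<^sup>2) - (of_int m)\<^sup>2 / L"
    using assms(1) unfolding sum_frequencies by (simp add: field_simps power2_eq_square)
  finally show ?thesis using sum_squares by linarith
qed

lemma window_variance_less_1:
  assumes x: "uniform_pair_distances x" and L: "0 < L" "0 \<le> m" "2 * m \<le> L"
  shows "\<forall>\<^sub>F N in sequentially. window_variance x N L m < 1"
proof -
  have "(\<lambda>N. \<Sum>v=1..m. pair_frequency x N (of_int v / of_int L)) \<longlonglongrightarrow> (\<Sum>v=1..m. 2 * (of_int v / of_int L))"
  proof (rule tendsto_sum)
    fix v assume "v \<in> {1..m}"
    then have "real_of_int v / L \<in> {0..1/2}" using L by (auto simp: field_simps)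
    with x show "(\<lambda>N. pair_frequency x N (of_int v / of_int L)) \<longlonglongrightarrow> 2 * (of_int v / of_int L)"
      unfolding uniform_pair_distances_def by blast
  qed
  moreover have "(\<Sum>v=1..m. 2 * (of_int v / of_int L)) = m * (m + 1) / L"
    using L(2)
  proof (induction m rule: int_ge_induct)
    case (step m)
    have "{1..m + 1} = insert (m + 1) {1..m}" using step(1) by auto
    with step L(1) show ?case by (simp add: field_simps)
  qed simp
  moreover have "m * (m + 1) / L < (of_int m)\<^sup>2 / L + 1"
    using L by (simp add: field_simps power2_eq_square)
  ultimately have "\<forall>\<^sub>F N in sequentially. (\<Sum>v=1..m. pair_frequency x N (of_int v / of_int L)) < (of_int m)\<^sup>2 / L + 1"
    by (simp only: order_tendstoD(2))
  with eventually_gt_at_top[of 0] show ?thesis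
  proof eventually_elim
    case (elim N)
    then show ?case using window_variance_le[OF L elim(1), of x] by linarith
  qed
qed

lemma le_add_if_sum_squares_less:
  fixes f :: "'a \<Rightarrow> real" and p c \<eta> :: real
  assumes "finite S" "T \<subseteq> S" "0 \<le> \<eta>" and p: "\<And>s. s \<in> T \<Longrightarrow> p \<le> f s"
    and "(\<Sum>s\<in>S. (f s - c)\<^sup>2) < card T * \<eta>\<^sup>2"
  shows "p \<le> c + \<eta>"
proof (rule ccontr)
  assume "\<not> p \<le> c + \<eta>"
  then have "\<eta>\<^sup>2 \<le> (f s - c)\<^sup>2" if "s \<in> T" for s
    using p[OF that] assms(3) by (intro power_mono) auto
  then have "card T * \<eta>\<^sup>2 \<le> (\<Sum>s\<in>T. (f s - c)\<^sup>2)" by (rule sum_bounded_below)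
  also have "\<dots> \<le> (\<Sum>s\<in>S. (f s - c)\<^sup>2)" using assms by (intro sum_mono2) auto
  finally show False using assms by simp
qed

lemma frequency_interval_le_window:
  fixes L m q :: int and a b :: real
  assumes x: "uniform_pair_distances x" and "a \<le> b" "0 < L" "0 < q"
    and m: "m = \<lfloor>L * b\<rfloor> - \<lfloor>L * a\<rfloor> + q\<^sup>2" "2 * m \<le> L"
  shows "\<forall>\<^sub>F N in sequentially. frequency N (\<lambda>i. x i \<in> {a..b}) \<le> m / L + 1 / q"
proof -
  have "L * a \<le> L * b" using assms by simp
  then have m_ge: "q\<^sup>2 \<le> m" unfolding m(1) using floor_mono by force
  then have m_nonneg: "0 \<le> m" by (rule order_trans[rotated]) simp
  define T where "T = {s \<in> {0..<L}. a \<in> circle_window L (q\<^sup>2) s}"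
  have "card T = nat (q\<^sup>2)"
    unfolding T_def using m(2) m_ge m_nonneg \<open>0 < L\<close> by (intro card_circle_windows_containing) auto
  then have card_T: "card T * (1 / q)\<^sup>2 = 1" using \<open>0 < q\<close> by (simp add: power_divide)
  have "\<forall>\<^sub>F N in sequentially. window_variance x N L m < 1"
    using x \<open>0 < L\<close> m_nonneg m(2) by (rule window_variance_less_1)
  then show ?thesis
  proof eventually_elim
    case (elim N)
    show ?case
    proof (rule le_add_if_sum_squares_less)
      show "(\<Sum>s\<in>{0..<L}. (frequency N (\<lambda>i. x i \<in> circle_window L m s) - m / L)\<^sup>2)
          < card T * (1 / q)\<^sup>2"
        unfolding card_T using elim by (simp add: window_variance_def)
      fix s assume "s \<in> T"
      then have "{a..b} \<subseteq> circle_window L m s"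
        using m m_nonneg \<open>0 < L\<close> by (intro interval_subset_circle_window) (auto simp: T_def)
      then show "frequency N (\<lambda>i. x i \<in> {a..b}) \<le> frequency N (\<lambda>i. x i \<in> circle_window L m s)"
        by (intro frequency_mono) auto
    qed (use \<open>0 < q\<close> in \<open>auto simp: T_def\<close>)
  qed
qed

lemma frequency_short_interval_le:
  fixes q :: int
  assumes x: "uniform_pair_distances x" and ab: "a \<le> b" "b - a \<le> 1/4" and "5 \<le> q"
  shows "\<forall>\<^sub>F N in sequentially. frequency N (\<lambda>i. x i \<in> {a..b}) \<le> b - a + 3 / q"
proof -
  define L where "L = q ^ 3"
  define m where "m = \<lfloor>L * b\<rfloor> - \<lfloor>L * a\<rfloor> + q\<^sup>2"
  have q: "0 < q" "5 \<le> real_of_int q" using \<open>5 \<le> q\<close> by simp_all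
  have L_eq: "real_of_int L = q * q\<^sup>2" by (simp add: L_def power3_eq_cube power2_eq_square)
  have "0 < L" using q by (simp add: L_def)
  have q_squared: "25 \<le> (real_of_int q)\<^sup>2" "5 * (real_of_int q)\<^sup>2 \<le> L"
    using power_mono[OF q(2), of 2] q by (simp_all add: L_eq mult_right_mono)
  have "real_of_int m = \<lfloor>L * b\<rfloor> - \<lfloor>L * a\<rfloor> + q\<^sup>2" by (simp add: m_def)
  then have m_le: "m \<le> L * (b - a) + 1 + q\<^sup>2" by (simp add: algebra_simps) linarith
  also have "L * (b - a) \<le> L * (1/4)" using ab \<open>0 < L\<close> by (intro mult_left_mono) auto
  finally have "2 * real_of_int m \<le> L" using q_squared by simp
  then have "2 * m \<le> L" by linarith
  with x ab(1) \<open>0 < L\<close> q(1) m_def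
  have "\<forall>\<^sub>F N in sequentially. frequency N (\<lambda>i. x i \<in> {a..b}) \<le> m / L + 1 / q"
    by (rule frequency_interval_le_window)
  moreover have "m / L + 1 / q \<le> b - a + 3 / q"
  proof -
    have "m / L \<le> (L * (b - a) + 2 * q\<^sup>2) / L"
      using m_le q_squared \<open>0 < L\<close> by (intro divide_right_mono) auto
    also have "\<dots> = b - a + 2 / q"
      using \<open>0 < L\<close> q unfolding L_eq by (simp add: add_divide_distrib)
    finally show ?thesis by simp
  qed
  ultimately show ?thesis by (auto elim: eventually_mono)
qed

definition upper_uniform :: "(nat \<Rightarrow> real) \<Rightarrow> real \<Rightarrow> bool" where
  "upper_uniform x \<delta> \<longleftrightarrow> (\<forall>a b \<epsilon>. a \<le> b \<and> b - a \<le> \<delta> \<and> 0 < \<epsilon> \<longrightarrow>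
     (\<forall>\<^sub>F N in sequentially. frequency N (\<lambda>i. x i \<in> {a..b}) \<le> b - a + \<epsilon>))"

lemma upper_uniform_quarter:
  assumes "uniform_pair_distances x"
  shows "upper_uniform x (1/4)"
  unfolding upper_uniform_def
proof (intro allI impI, elim conjE)
  fix a b \<epsilon> :: real assume ab: "a \<le> b" "b - a \<le> 1/4" and "0 < \<epsilon>"
  define q where "q = max 5 \<lceil>3 / \<epsilon>\<rceil>"
  have "5 \<le> q" by (simp add: q_def)
  have "3 / \<epsilon> \<le> q" unfolding q_def by linarith
  with \<open>5 \<le> q\<close> \<open>0 < \<epsilon>\<close> have "3 / q \<le> \<epsilon>" by (simp add: field_simps)
  with frequency_short_interval_le[OF assms ab \<open>5 \<le> q\<close>]
  show "\<forall>\<^sub>F N in sequentially. frequency N (\<lambda>i. x i \<in> {a..b}) \<le> b - a + \<epsilon>"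
    by (auto elim: eventually_mono)
qed

lemma upper_uniform_double:
  assumes "upper_uniform x \<delta>"
  shows "upper_uniform x (2 * \<delta>)"
  unfolding upper_uniform_def
proof (intro allI impI, elim conjE)
  fix a b \<epsilon> :: real assume ab: "a \<le> b" "b - a \<le> 2 * \<delta>" and "0 < \<epsilon>"
  define c where "c = (a + b) / 2"
  have "\<forall>\<^sub>F N in sequentially. frequency N (\<lambda>i. x i \<in> {a..c}) \<le> c - a + \<epsilon> / 2"
    "\<forall>\<^sub>F N in sequentially. frequency N (\<lambda>i. x i \<in> {c..b}) \<le> b - c + \<epsilon> / 2"
    using ab \<open>0 < \<epsilon>\<close>
    by (intro assms[unfolded upper_uniform_def, rule_format]; simp add: c_def field_simps)+
  then show "\<forall>\<^sub>F N in sequentially. frequency N (\<lambda>i. x i \<in> {a..b}) \<le> b - a + \<epsilon>"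
  proof eventually_elim
    case (elim N)
    have "frequency N (\<lambda>i. x i \<in> {a..b}) \<le> frequency N (\<lambda>i. x i \<in> {a..c} \<or> x i \<in> {c..b})"
      by (rule frequency_mono) auto
    with frequency_disj_le[of N "\<lambda>i. x i \<in> {a..c}" "\<lambda>i. x i \<in> {c..b}"] elim show ?case
      by linarith
  qed
qed

lemma uniformly_distributed_if_upper_uniform:
  assumes x: "\<And>n. n \<ge> 1 \<Longrightarrow> x n \<in> {0..1}" and "upper_uniform x 1"
  shows "uniformly_distributed_mod_1 x"
  unfolding uniformly_distributed_mod_1_iff_frequency
proof (intro allI impI tendstoI)
  fix a b \<epsilon> :: real
  assume ab: "0 \<le> a \<and> a < b \<and> b \<le> 1" and "\<epsilon> > 0"
  let ?F = "\<lambda>N a b. frequency N (\<lambda>i. x i \<in> {a..b})"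
  have "\<forall>\<^sub>F N in sequentially. ?F N a b \<le> (b - a) + \<epsilon> / 3"
    "\<forall>\<^sub>F N in sequentially. ?F N 0 a \<le> (a - 0) + \<epsilon> / 3"
    "\<forall>\<^sub>F N in sequentially. ?F N b 1 \<le> (1 - b) + \<epsilon> / 3"
    using ab \<open>\<epsilon> > 0\<close> by (intro assms(2)[unfolded upper_uniform_def, rule_format]; simp)+
  with eventually_gt_at_top[of 0]
  show "\<forall>\<^sub>F N in sequentially. dist (?F N a b) (b - a) < \<epsilon>"
  proof eventually_elim
    case (elim N)
    have "\<bar>?F N a b - (b - a)\<bar> \<le> 2 * (\<epsilon> / 3)"
      using elim \<open>\<epsilon> > 0\<close> x by (intro abs_frequency_diff_le_if_cover[OF _ _ _ elim(2-4)]) force+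
    with \<open>\<epsilon> > 0\<close> show ?case by (simp add: dist_real_def)
  qed
qed

lemma uniformly_distributed_if_uniform_pair_distances:
  assumes "\<And>n. n \<ge> 1 \<Longrightarrow> x n \<in> {0..1}" "uniform_pair_distances x"
  shows "uniformly_distributed_mod_1 x"
  using assms(1)
proof (rule uniformly_distributed_if_upper_uniform)
  show "upper_uniform x 1"
    using upper_uniform_double[OF upper_uniform_double[OF upper_uniform_quarter[OF assms(2)]]] by simp
qed

section \<open>Counting tuples\<close>

lemma card_PiE_star:
  assumes "finite S" "finite B" "r \<notin> B"
  shows "card {i \<in> insert r B \<rightarrow>\<^sub>E S. \<forall>n\<in>B. P n (i r) (i n)} = (\<Sum>j\<in>S. \<Prod>n\<in>B. card {l \<in> S. P n j l})"
proof -
  define A where "A j n = (if n = r then {j} else {l \<in> S. P n j l})" for j n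
  have A_simps: "A j r = {j}" "n \<in> B \<Longrightarrow> A j n = {l \<in> S. P n j l}" for j n
    using assms(3) by (auto simp: A_def)
  have "{i \<in> insert r B \<rightarrow>\<^sub>E S. \<forall>n\<in>B. P n (i r) (i n)} = (\<Union>j\<in>S. Pi\<^sub>E (insert r B) (A j))"
    by (auto simp: PiE_iff A_simps)
  also have "card \<dots> = (\<Sum>j\<in>S. card (Pi\<^sub>E (insert r B) (A j)))"
  proof (rule card_UN_disjoint[OF assms(1)])
    show "\<forall>j\<in>S. finite (Pi\<^sub>E (insert r B) (A j))"
      using assms by (auto intro!: finite_PiE simp: A_def)
    show "\<forall>j\<in>S. \<forall>j'\<in>S. j \<noteq> j' \<longrightarrow> Pi\<^sub>E (insert r B) (A j) \<inter> Pi\<^sub>E (insert r B) (A j') = {}"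
      by (auto simp: PiE_iff A_simps)
  qed
  also have "\<dots> = (\<Sum>j\<in>S. \<Prod>n\<in>B. card {l \<in> S. P n j l})"
    using assms(2,3) by (simp add: card_PiE A_simps)
  finally show ?thesis .
qed

definition tuple_frequency :: "'i set \<Rightarrow> nat \<Rightarrow> (('i \<Rightarrow> nat) \<Rightarrow> bool) \<Rightarrow> real" where
  "tuple_frequency A N P = real (card {i \<in> A \<rightarrow>\<^sub>E {1..N}. P i}) / real N ^ card A"

lemma tuple_frequency_True: "finite A \<Longrightarrow> N > 0 \<Longrightarrow> tuple_frequency A N (\<lambda>_. True) = 1"
  by (simp add: tuple_frequency_def card_PiE)

lemma finite_tuples: "finite A \<Longrightarrow> finite {i \<in> A \<rightarrow>\<^sub>E {1..N}. P i}" for N :: nat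
  by (rule rev_finite_subset[of "A \<rightarrow>\<^sub>E {1..N}"]) (auto simp: finite_PiE)

lemma tuple_frequency_mono:
  assumes "finite A" "\<And>i. P i \<Longrightarrow> Q i"
  shows "tuple_frequency A N P \<le> tuple_frequency A N Q"
  unfolding tuple_frequency_def using assms
  by (intro divide_right_mono of_nat_mono card_mono finite_tuples) auto

lemma tuple_frequency_diff:
  assumes "finite A"
  shows "tuple_frequency A N Q - tuple_frequency A N (\<lambda>i. P i \<and> Q i) = tuple_frequency A N (\<lambda>i. \<not> P i \<and> Q i)"
proof -
  have "card {i \<in> A \<rightarrow>\<^sub>E {1..N}. Q i}
      = card ({i \<in> A \<rightarrow>\<^sub>E {1..N}. P i \<and> Q i} \<union> {i \<in> A \<rightarrow>\<^sub>E {1..N}. \<not> P i \<and> Q i})"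
    by (rule arg_cong[where f = card]) auto
  also have "\<dots> = card {i \<in> A \<rightarrow>\<^sub>E {1..N}. P i \<and> Q i} + card {i \<in> A \<rightarrow>\<^sub>E {1..N}. \<not> P i \<and> Q i}"
    using finite_tuples[OF assms] by (intro card_Un_disjoint) auto
  finally show ?thesis by (simp add: tuple_frequency_def add_divide_distrib)
qed

lemma tuple_frequency_inj_tendsto:
  assumes "finite A"
  shows "(\<lambda>N. tuple_frequency A N (\<lambda>i. inj_on i A)) \<longlonglongrightarrow> 1"
proof -
  have "(\<lambda>N. \<Prod>l<card A. 1 - real l * (1 / real N)) \<longlonglongrightarrow> (\<Prod>l<card A. 1 - real l * 0)"
    by (intro tendsto_intros lim_1_over_n)
  moreover have "\<forall>\<^sub>F N in sequentially.
      (\<Prod>l<card A. 1 - real l * (1 / real N)) = tuple_frequency A N (\<lambda>i. inj_on i A)"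
    using eventually_gt_at_top[of "card A"]
  proof eventually_elim
    case (elim N)
    have "card {i \<in> A \<rightarrow>\<^sub>E {1..N}. inj_on i A} = (\<Prod>l<card A. N - l)"
      using card_inj_on_subset_funcset[OF assms, of "{1..N}" A] by (simp add: lessThan_atLeast0)
    also have "real \<dots> = (\<Prod>l<card A. real N - real l)"
      using elim unfolding of_nat_prod by (intro prod.cong) (auto simp: of_nat_diff)
    finally have "tuple_frequency A N (\<lambda>i. inj_on i A) = (\<Prod>l<card A. (real N - real l) / real N)"
      by (simp add: tuple_frequency_def prod_dividef)
    also have "\<dots> = (\<Prod>l<card A. 1 - real l * (1 / real N))"
      using elim by (intro prod.cong) (auto simp: diff_divide_distrib)
    finally show ?case by simp
  qed
  ultimately show ?thesis by (simp add: Lim_transform_eventually)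
qed

lemma noninjective_tuples_negligible:
  assumes "finite A"
  shows "(\<lambda>N. tuple_frequency A N (P N) - tuple_frequency A N (\<lambda>i. inj_on i A \<and> P N i)) \<longlonglongrightarrow> 0"
proof -
  have "(\<lambda>N. 1 - tuple_frequency A N (\<lambda>i. inj_on i A)) \<longlonglongrightarrow> 1 - 1"
    by (intro tendsto_intros tuple_frequency_inj_tendsto assms)
  then have majorant: "(\<lambda>N. 1 - tuple_frequency A N (\<lambda>i. inj_on i A)) \<longlonglongrightarrow> 0" by simp
  show ?thesis
    unfolding tuple_frequency_diff[OF assms]
  proof (rule tendsto_sandwich[OF _ _ tendsto_const majorant])
    show "\<forall>\<^sub>F N in sequentially. 0 \<le> tuple_frequency A N (\<lambda>i. \<not> inj_on i A \<and> P N i)"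
      by (simp add: tuple_frequency_def)
    show "\<forall>\<^sub>F N in sequentially. tuple_frequency A N (\<lambda>i. \<not> inj_on i A \<and> P N i)
        \<le> 1 - tuple_frequency A N (\<lambda>i. inj_on i A)"
      using eventually_gt_at_top[of 0]
    proof eventually_elim
      case (elim N)
      have "tuple_frequency A N (\<lambda>i. \<not> inj_on i A \<and> P N i) \<le> tuple_frequency A N (\<lambda>i. \<not> inj_on i A)"
        using assms by (rule tuple_frequency_mono) simp
      also have "\<dots> = 1 - tuple_frequency A N (\<lambda>i. inj_on i A)"
        using tuple_frequency_diff[OF assms, of N "\<lambda>_. True" "\<lambda>i. inj_on i A"]
        by (simp add: tuple_frequency_True[OF assms elim])
      finally show ?case .
    qed
  qed
qed

section \<open>Poissonian correlations\<close>

definition rectangle_frequency ::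
    "(nat \<Rightarrow> real) \<Rightarrow> nat \<Rightarrow> (nat \<Rightarrow> real) \<Rightarrow> (nat \<Rightarrow> real) \<Rightarrow> nat \<Rightarrow> real" where
  "rectangle_frequency x d a b N =
     average N (\<lambda>j. \<Prod>m=1..d. frequency N (\<lambda>l. signed_dist (x j - x l) \<in> {a m..b m}))"

lemma tuple_frequency_scaled_differences:
  assumes "k \<ge> 1" "N > 0"
  shows "tuple_frequency {1..k} N (\<lambda>i. scaled_differences x k 0 N i \<in> (\<Pi>\<^sub>E m\<in>{1..k-1}. {a m..b m}))
           = rectangle_frequency x (k - 1) a b N"
proof -
  define P where "P n j l \<longleftrightarrow> signed_dist (x j - x l) \<in> {a (n - 1)..b (n - 1)}" for n j l
  have indices: "{1..k} = insert 1 (Suc ` {1..k-1})"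
    using assms(1) by (auto simp: image_Suc_atLeastAtMost)
  have "card {i \<in> {1..k} \<rightarrow>\<^sub>E {1..N}. scaled_differences x k 0 N i \<in> (\<Pi>\<^sub>E m\<in>{1..k-1}. {a m..b m})}
      = card {i \<in> insert 1 (Suc ` {1..k-1}) \<rightarrow>\<^sub>E {1..N}. \<forall>n\<in>Suc ` {1..k-1}. P n (i 1) (i n)}"
    unfolding indices[symmetric] using assms(2)
    by (intro arg_cong[where f = card])
       (auto simp: scaled_differences_def P_def PiE_iff simp del: image_Suc_atLeastAtMost)
  also have "\<dots> = (\<Sum>j=1..N. \<Prod>n\<in>Suc ` {1..k-1}. card {l \<in> {1..N}. P n j l})"
    by (rule card_PiE_star) simp_all
  also have "\<dots> = (\<Sum>j=1..N. \<Prod>m=1..k-1. card {l \<in> {1..N}. signed_dist (x j - x l) \<in> {a m..b m}})"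
    by (simp only: P_def prod.reindex[OF inj_Suc] o_def diff_Suc_1)
  finally show ?thesis
    using assms(1) power_Suc[of "real N" "k - 1"]
    by (simp add: tuple_frequency_def rectangle_frequency_def average_def frequency_eq_card
        prod_dividef sum_divide_distrib[symmetric] mult.commute)
qed

lemma correlation_count_asymp:
  assumes "k \<ge> 1"
  shows "(\<lambda>N. rectangle_frequency x (k - 1) a b N
            - correlation_count x k 0 (\<Pi>\<^sub>E m\<in>{1..k-1}. {a m..b m}) N) \<longlonglongrightarrow> 0"
proof (rule Lim_transform_eventually)
  let ?P = "\<lambda>N i. scaled_differences x k 0 N i \<in> (\<Pi>\<^sub>E m\<in>{1..k-1}. {a m..b m})"
  show "(\<lambda>N. tuple_frequency {1..k} N (?P N) - tuple_frequency {1..k} N (\<lambda>i. inj_on i {1..k} \<and> ?P N i)) \<longlonglongrightarrow> 0"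
    using noninjective_tuples_negligible[of "{1..k}" ?P] by simp
  show "\<forall>\<^sub>F N in sequentially. tuple_frequency {1..k} N (?P N) - tuple_frequency {1..k} N (\<lambda>i. inj_on i {1..k} \<and> ?P N i)
      = rectangle_frequency x (k - 1) a b N - correlation_count x k 0 (\<Pi>\<^sub>E m\<in>{1..k-1}. {a m..b m}) N"
    using eventually_gt_at_top[of 0]
  proof eventually_elim
    case (elim N)
    then have "tuple_frequency {1..k} N (\<lambda>i. inj_on i {1..k} \<and> ?P N i)
        = correlation_count x k 0 (\<Pi>\<^sub>E m\<in>{1..k-1}. {a m..b m}) N"
      by (simp add: tuple_frequency_def correlation_count_def powr_realpow)
    then show ?case
      using tuple_frequency_scaled_differences[OF assms elim] by simp
  qed
qed

lemma measure_rectangle: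
  fixes a b :: "'i \<Rightarrow> real"
  assumes "finite I" "\<And>m. m \<in> I \<Longrightarrow> a m \<le> b m"
  shows "measure (Pi\<^sub>M I (\<lambda>_. lborel)) (\<Pi>\<^sub>E m\<in>I. {a m..b m}) = (\<Prod>m\<in>I. b m - a m)"
proof -
  interpret product_sigma_finite "\<lambda>_. lborel :: real measure" ..
  have "emeasure (Pi\<^sub>M I (\<lambda>_. lborel)) (\<Pi>\<^sub>E m\<in>I. {a m..b m}) = (\<Prod>m\<in>I. emeasure lborel {a m..b m})"
    using assms(1) by (intro emeasure_PiM) auto
  also have "\<dots> = (\<Prod>m\<in>I. ennreal (b m - a m))"
    using assms(2) by (intro prod.cong) auto
  also have "\<dots> = ennreal (\<Prod>m\<in>I. b m - a m)"
    using assms(2) by (intro prod_ennreal) auto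
  finally show ?thesis
    using assms(2) by (simp add: measure_def prod_nonneg)
qed

lemma poissonian_k0_correlations_iff:
  assumes k: "k \<ge> 1"
  shows "poissonian_k0_correlations k x \<longleftrightarrow>
     (\<forall>a b. (\<forall>m\<in>{1..k-1}. -(1/2) \<le> a m \<and> a m \<le> b m \<and> b m \<le> 1/2) \<longrightarrow>
        rectangle_frequency x (k - 1) a b \<longlonglongrightarrow> (\<Prod>m=1..k-1. b m - a m))"
    (is "_ \<longleftrightarrow> (\<forall>a b. ?inside a b \<longrightarrow> ?lim a b)")
proof -
  let ?R = "\<lambda>a b. \<Pi>\<^sub>E m\<in>{1..k-1}. {a m..b m :: real}"
  let ?corr = "\<lambda>a b. correlation_count x k 0 (?R a b) \<longlonglongrightarrow> measure (Pi\<^sub>M {1..k-1} (\<lambda>_. lborel)) (?R a b)"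
  have corr: "?corr a b \<longleftrightarrow> ?lim a b" if "?inside a b" for a b
  proof -
    have "measure (Pi\<^sub>M {1..k-1} (\<lambda>_. lborel)) (?R a b) = (\<Prod>m=1..k-1. b m - a m)"
      using that by (intro measure_rectangle) auto
    then show ?thesis
      using Lim_transform_eq[OF correlation_count_asymp[OF k, of x a b]] by simp
  qed
  have inside: "(\<forall>m\<in>{1..k-1}. a m \<le> b m) \<and> ?R a b \<subseteq> (\<Pi>\<^sub>E m\<in>{1..k-1}. {-(1/2)..1/2}) \<longleftrightarrow> ?inside a b" for a b
    unfolding subset_PiE by (fastforce simp: PiE_eq_empty_iff)
  have "poissonian_k0_correlations k x \<longleftrightarrow> (\<forall>a b. ?inside a b \<longrightarrow> ?corr a b)"
    unfolding poissonian_k0_correlations_def closed_rectangle_def inside[symmetric] by blast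
  with corr show ?thesis by blast
qed

lemma uniform_limit_prod_const:
  fixes f :: "'i \<Rightarrow> 'n \<Rightarrow> 'a \<Rightarrow> 'c::{real_normed_algebra_1, comm_monoid_mult}"
  assumes "\<And>i. i \<in> I \<Longrightarrow> uniform_limit S (f i) (\<lambda>_. c i) F"
  shows "uniform_limit S (\<lambda>n x. \<Prod>i\<in>I. f i n x) (\<lambda>_. \<Prod>i\<in>I. c i) F"
  using assms
proof (induction I rule: infinite_finite_induct)
  case (insert i I)
  then have "uniform_limit S (\<lambda>n x. f i n x * (\<Prod>i\<in>I. f i n x)) (\<lambda>_. c i * (\<Prod>i\<in>I. c i)) F"
    by (intro uniform_lim_mult) (auto simp: image_constant_conv)
  with insert show ?case by simp
qed (simp_all add: uniform_limit_const)

lemma poissonian_if_uniformly_distributed: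
  assumes "k \<ge> 1" and x: "\<And>n. n \<ge> 1 \<Longrightarrow> x n \<in> {0..1}" and ud: "uniformly_distributed_mod_1 x"
  shows "poissonian_k0_correlations k x"
  unfolding poissonian_k0_correlations_iff[OF assms(1)]
proof (intro allI impI)
  fix a b :: "nat \<Rightarrow> real"
  assume ab: "\<forall>m\<in>{1..k-1}. -(1/2) \<le> a m \<and> a m \<le> b m \<and> b m \<le> 1/2"
  have "uniform_limit UNIV (\<lambda>N j. frequency N (\<lambda>l. signed_dist (x j - x l) \<in> {a m..b m}))
      (\<lambda>_. b m - a m) sequentially" if "m \<in> {1..k-1}" for m
  proof (rule uniform_limit_compose'[where f = "\<lambda>N y. frequency N (\<lambda>l. signed_dist (y - x l) \<in> {a m..b m})"])
    show "uniform_limit UNIV (\<lambda>N y. frequency N (\<lambda>l. signed_dist (y - x l) \<in> {a m..b m}))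
        (\<lambda>_. b m - a m) sequentially"
      using ud x ab that by (intro uniform_limit_frequency_arc) auto
  qed simp
  then have "uniform_limit UNIV
      (\<lambda>N j. \<Prod>m=1..k-1. frequency N (\<lambda>l. signed_dist (x j - x l) \<in> {a m..b m}))
      (\<lambda>_. \<Prod>m=1..k-1. b m - a m) sequentially"
    by (rule uniform_limit_prod_const)
  then show "rectangle_frequency x (k - 1) a b \<longlonglongrightarrow> (\<Prod>m=1..k-1. b m - a m)"
    unfolding rectangle_frequency_def by (rule tendsto_average_uniform_limit)
qed

lemma uniform_pair_distances_if_poissonian:
  assumes k: "k \<ge> 2" and x: "poissonian_k0_correlations k x"
  shows "uniform_pair_distances x"
  unfolding uniform_pair_distances_def
proof
  fix c :: real assume c_range: "c \<in> {0..1/2}"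
  define b where "b m = (if m = 1 then c else 1/2)" for m :: nat
  have b_bounds: "-(1/2) \<le> - b m" "- b m \<le> b m" "b m \<le> 1/2" for m using c_range by (auto simp: b_def)
  have indices: "{1..k-1} = insert 1 {2..k-1}" and "k \<ge> 1" using k by auto
  have "rectangle_frequency x (k - 1) (\<lambda>m. - b m) b \<longlonglongrightarrow> (\<Prod>m=1..k-1. b m - - b m)"
    using b_bounds by (intro x[unfolded poissonian_k0_correlations_iff[OF \<open>k \<ge> 1\<close>], rule_format]) blast
  also have "(\<Prod>m=1..k-1. b m - - b m) = 2 * c"
    unfolding indices by (simp add: b_def)
  finally have "rectangle_frequency x (k - 1) (\<lambda>m. - b m) b \<longlonglongrightarrow> 2 * c" .
  moreover have "\<forall>\<^sub>F N in sequentially. rectangle_frequency x (k - 1) (\<lambda>m. - b m) b N = pair_frequency x N c"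
    using eventually_gt_at_top[of 0]
  proof eventually_elim
    case (elim N)
    have "frequency N (\<lambda>l. signed_dist (x j - x l) \<in> {- b m..b m}) = 1" if "m \<noteq> 1" for j m
      using that signed_dist_bounds by (intro frequency_eq_1 elim) (auto simp: b_def less_imp_le)
    then have "(\<Prod>m\<in>{2..k-1}. frequency N (\<lambda>l. signed_dist (x j - x l) \<in> {- b m..b m})) = 1" for j
      by (intro prod.neutral) auto
    then have "(\<Prod>m=1..k-1. frequency N (\<lambda>l. signed_dist (x j - x l) \<in> {- b m..b m}))
        = frequency N (\<lambda>l. signed_dist (x j - x l) \<in> {- b 1..b 1})" for j
      unfolding indices by (subst prod.insert) auto
    then show ?case
      by (simp add: rectangle_frequency_def pair_frequency_def b_def abs_le_iff minus_le_iff conj_commute)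
  qed
  ultimately show "(\<lambda>N. pair_frequency x N c) \<longlonglongrightarrow> 2 * c"
    by (rule Lim_transform_eventually)
qed

theorem theorem7:
  fixes k :: nat and x :: "nat \<Rightarrow> real"
  assumes "k \<ge> 2"
    and "\<And>n. n \<ge> 1 \<Longrightarrow> x n \<in> {0..1}"
  shows "uniformly_distributed_mod_1 x \<longleftrightarrow> poissonian_k0_correlations k x"
proof
  assume "uniformly_distributed_mod_1 x"
  then show "poissonian_k0_correlations k x"
    using assms by (intro poissonian_if_uniformly_distributed) auto
next
  assume "poissonian_k0_correlations k x"
  with assms(1) have "uniform_pair_distances x"
    by (rule uniform_pair_distances_if_poissonian)
  with assms(2) show "uniformly_distributed_mod_1 x"
    by (rule uniformly_distributed_if_uniform_pair_distances)
qed

end
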